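(* Let $G$ be a $2$-connected graph. If the length of every cycle in $G$ is divisible by $3$, then $\mathrm{spc}(G) \leq 3$.
   Context: Graphs are finite, simple and connected. A graph is $k$-connected if it cannot be disconnected by deleting $k-1$ vertices. In a graph with colored edges (the coloring is arbitrary; adjacent edges may share a color), a path is strongly proper if its sequence of edge colors does not contain identical terms within a distance of at most two, i.e. any two distinct edges of the path that are consecutive on the path, or separated by exactly one edge on the path, have different colors. An edge-colored graph is strongly proper connected if every two distinct vertices are joined by at least one strongly proper path. $\mathrm{spc}(G)$ denotes the least number of colors in an edge coloring of $G$ that makes $G$ strongly proper connected. *)

theory Defs
  imports "Graph_Theory.Digraph_Component"
begin

text \<open>
  A finite simple graph is an instance of the locale \<^locale>\<open>graph\<close>, i.e. a finite symmetric
  digraph without loops and parallel arcs. Every undirected edge is thus represented by two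
  opposite arcs; it is identified here with its set of end vertices.
\<close>

definition arc_edge :: "('a,'b) pre_digraph \<Rightarrow> 'b \<Rightarrow> 'a set" where
  "arc_edge G a = {tail G a, head G a}"

definition edges :: "('a,'b) pre_digraph \<Rightarrow> 'a set set" where
  "edges G = arc_edge G ` arcs G"

text \<open>
  Taking \<^term>\<open>S = {}\<close> covers connectedness of the graph itself. Deleting all the vertices does not
  count as disconnecting, and there is no lower bound on the number of vertices, so that for
  example the complete graph on two vertices is 2-connected.
\<close>

definition k_connected :: "nat \<Rightarrow> ('a,'b) pre_digraph \<Rightarrow> bool" where
  "k_connected k G \<longleftrightarrow>
     (\<forall>S. S \<subset> verts G \<and> card S < k \<longrightarrow> Digraph_Component.connected (G \<restriction> (verts G - S)))"

text \<open>
  \<^const>\<open>pre_digraph.cycle\<close> admits the closed walk of length two that runs along an edge and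
  back; this is not a cycle of the undirected graph.
\<close>

definition graph_cycle :: "('a,'b) pre_digraph \<Rightarrow> 'b list \<Rightarrow> bool" where
  "graph_cycle G p \<longleftrightarrow> pre_digraph.cycle G p \<and> 3 \<le> length p"

text \<open>
  A colouring assigns colours to undirected edges, so both arcs of an edge get the same colour.
\<close>

definition strongly_proper :: "('a,'b) pre_digraph \<Rightarrow> ('a set \<Rightarrow> nat) \<Rightarrow> 'b list \<Rightarrow> bool" where
  "strongly_proper G c p \<longleftrightarrow>
     (\<forall>i j. i < j \<and> j \<le> i + 2 \<and> j < length p \<longrightarrow>
        c (arc_edge G (p ! i)) \<noteq> c (arc_edge G (p ! j)))"

definition strongly_proper_connected :: "('a,'b) pre_digraph \<Rightarrow> ('a set \<Rightarrow> nat) \<Rightarrow> bool" where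
  "strongly_proper_connected G c \<longleftrightarrow>
     (\<forall>u \<in> verts G. \<forall>v \<in> verts G. u \<noteq> v \<longrightarrow>
        (\<exists>p. pre_digraph.apath G u p v \<and> strongly_proper G c p))"

text \<open>
  For a connected finite graph the minimum exists: a colouring that is injective on the edges
  makes every path strongly proper.
\<close>

definition spc :: "('a,'b) pre_digraph \<Rightarrow> nat" where
  "spc G = (LEAST k. \<exists>c. card (c ` edges G) = k \<and> strongly_proper_connected G c)"

end

theory Submission
  imports Defs
begin

text \<open>
  Suppose that the vertices carry phases modulo 3 such that every two vertices are joined by a walk
  on which each step raises the phase by one. Colour the edge between vertices of phases \<open>a\<close>
  and \<open>a + 1\<close> by \<open>2 a + 1\<close> modulo 3, the sum of the two phases. On a walk with rising phases the
  colours then rotate through the three residues, so the walk, shortened to a path, is strongly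
  proper (\<open>phase_path_strongly_proper\<close>). It remains to find such phases.

  Take a maximal vertex set on which they exist; a single vertex shows that there is one. If
  the set misses a vertex, some edge leaves it, and by 2-connectedness (with at least three vertices;
  smaller graphs are trivial) this edge lies on a cycle
  (\<open>edge_on_cycle\<close>). Following the cycle up to its first return gives an ear: it leaves
  the set at \<open>u\<close>, runs outside, and comes back at \<open>v\<close>, possibly with \<open>v = u\<close>. Continue the rising
  phases from \<open>u\<close> along the ear. The only question is whether the last step, into \<open>v\<close>, is also a
  rise. This is where cycle lengths enter (\<open>extend_by_ear\<close>): inside the set there is already a
  path with rising phases from \<open>v\<close> back to \<open>u\<close>; together with the ear it is a cycle of length divisible
  by 3, so going around it brings the phase back to its initial value. Hence the ear can be added,
  contradicting maximality.

  In effect the ears build a strongly connected orientation of a spanning subgraph in which the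
  phases rise along each arc; the edges outside the subgraph may have any colour.
\<close>

section \<open>Paths as vertex lists\<close>

lemma rtranclp_imp_path:
  assumes "R\<^sup>*\<^sup>* x y"
  obtains xs where "xs \<noteq> []" "hd xs = x" "last xs = y" "distinct xs" "successively R xs"
proof -
  from assms have "\<exists>xs. xs \<noteq> [] \<and> hd xs = x \<and> last xs = y \<and> distinct xs \<and> successively R xs"
  proof induction
    case base
    show ?case by (rule exI[of _ "[x]"]) simp
  next
    case (step y z)
    then obtain xs where xs: "xs \<noteq> []" "hd xs = x" "last xs = y" "distinct xs" "successively R xs"
      by blast
    show ?case
    proof (cases "z \<in> set xs")
      case True
      then obtain as bs where "xs = as @ z # bs" by (meson split_list)
      then have "xs = (as @ [z]) @ bs" by simp
      moreover have "hd (as @ [z]) = x" using xs(2) \<open>xs = as @ z # bs\<close> by (cases as) auto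
      ultimately show ?thesis
        using xs by (intro exI[of _ "as @ [z]"]) (simp add: successively_append_iff)
    next
      case False
      then show ?thesis
        using xs step.hyps
        by (intro exI[of _ "xs @ [z]"]) (simp add: successively_append_iff)
    qed
  qed
  then show thesis using that by blast
qed

lemma path_imp_rtranclp:
  assumes "successively R xs" "xs \<noteq> []"
  shows "R\<^sup>*\<^sup>* (hd xs) (last xs)"
  using assms
proof (induction xs rule: induct_list012)
  case (3 x y zs)
  then show ?case by (auto intro: converse_rtranclp_into_rtranclp)
qed auto

text \<open>
  As reachability along an induced relation never leaves the vertex set, this also confines the
  vertices of a path to that set.
\<close>

lemma path_through_imp_rtranclp:
  assumes "successively R xs" "z \<in> set xs"
  shows "R\<^sup>*\<^sup>* (hd xs) z" "R\<^sup>*\<^sup>* z (last xs)"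
proof -
  obtain as bs where xs: "xs = as @ z # bs" using assms(2) by (meson split_list)
  then have "xs = (as @ [z]) @ bs" by simp
  then have "successively R (as @ [z])" "successively R (z # bs)"
    using assms(1) xs by (metis successively_append_iff)+
  from this[THEN path_imp_rtranclp] show "R\<^sup>*\<^sup>* (hd xs) z" "R\<^sup>*\<^sup>* z (last xs)"
    using xs by (auto simp: hd_append split: if_splits)
qed

section \<open>Coherent phases\<close>

text \<open>
  Only the residue of a phase modulo 3 matters. Both ends of a step must lie in \<open>S\<close>, so that walks
  inside \<open>S\<close> are disjoint from ears outside it.
\<close>

definition phase_step :: "('a \<Rightarrow> 'a \<Rightarrow> bool) \<Rightarrow> ('a \<Rightarrow> nat) \<Rightarrow> 'a set \<Rightarrow> 'a \<Rightarrow> 'a \<Rightarrow> bool" where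
  "phase_step adj f S x y \<longleftrightarrow> x \<in> S \<and> y \<in> S \<and> adj x y \<and> f y mod 3 = Suc (f x) mod 3"

definition phase_strong :: "('a \<Rightarrow> 'a \<Rightarrow> bool) \<Rightarrow> ('a \<Rightarrow> nat) \<Rightarrow> 'a set \<Rightarrow> bool" where
  "phase_strong adj f S \<longleftrightarrow> (\<forall>x\<in>S. \<forall>y\<in>S. (phase_step adj f S)\<^sup>*\<^sup>* x y)"

lemma phase_along_path:
  assumes "successively (phase_step adj f S) xs" "i + k < length xs"
  shows "f (xs ! (i + k)) mod 3 = (f (xs ! i) + k) mod 3"
  using assms(2)
proof (induction k)
  case (Suc k)
  then have "phase_step adj f S (xs ! (i + k)) (xs ! Suc (i + k))"
    using assms(1) by (auto simp: successively_conv_nth)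
  then have "f (xs ! Suc (i + k)) mod 3 = Suc (f (xs ! (i + k))) mod 3"
    by (simp add: phase_step_def)
  also have "\<dots> = Suc (f (xs ! i) + k) mod 3"
    using Suc by (metis Suc_lessD add_Suc_right mod_Suc_eq)
  finally show ?case by simp
qed simp

text \<open>
  The phases on the ear \<open>W\<close> are forced by the one at \<open>u\<close>, and the arrival at \<open>v\<close> fits because a
  rising path from \<open>v\<close> to \<open>u\<close> inside \<open>S\<close> closes the ear to a cycle. The new
  set is strongly connected since each ear vertex is reached from \<open>u\<close> and reaches \<open>v\<close>. The condition
  \<open>proper_ear\<close> keeps the closed walk from being an edge run forth and back.
\<close>

lemma extend_by_ear:
  assumes cyc: "\<And>xs. distinct xs \<Longrightarrow> successively adj xs \<Longrightarrow> 3 \<le> length xs \<Longrightarrow> adj (last xs) (hd xs)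
                \<Longrightarrow> 3 dvd length xs"
    and strong: "phase_strong adj f S"
    and ends: "u \<in> S" "v \<in> S" "adj u (hd W)" "adj (last W) v"
    and W: "W \<noteq> []" "distinct W" "successively adj W" "set W \<inter> S = {}"
    and proper_ear: "u \<noteq> v \<or> 2 \<le> length W"
  shows "\<exists>g. phase_strong adj g (S \<union> set W)"
proof -
  have uv: "f v mod 3 = (f u + 1 + length W) mod 3"
  proof -
    have "(phase_step adj f S)\<^sup>*\<^sup>* v u"
      using strong ends by (simp add: phase_strong_def)
    then obtain q where q: "q \<noteq> []" "hd q = v" "last q = u" "distinct q"
        "successively (phase_step adj f S) q"
      by (rule rtranclp_imp_path)
    have qS: "set q \<subseteq> S"
    proof
      fix z assume "z \<in> set q"
      then have "(phase_step adj f S)\<^sup>*\<^sup>* v z"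
        using path_through_imp_rtranclp(1)[OF q(5)] q(2) by simp
      then show "z \<in> S"
        using ends(2) by (cases rule: rtranclp.cases) (auto simp: phase_step_def)
    qed
    have adj_q: "successively adj q"
      using q(5) by (rule successively_mono) (auto simp: phase_step_def)
    have len: "3 \<le> length (q @ W)"
    proof (cases "u = v")
      case True
      then show ?thesis using proper_ear q(1) by (cases q) auto
    next
      case False
      then have "length q \<noteq> 1" using q by (auto simp: length_Suc_conv)
      then show ?thesis using q(1) W(1) by (cases q; cases W) (auto simp: Suc_le_eq)
    qed
    have "3 dvd length (q @ W)"
      using q W qS ends adj_q len by (intro cyc) (auto simp: successively_append_iff)
    moreover define d where "d = length q - 1"
    ultimately have "3 dvd d + 1 + length W" using q(1) by (cases q) auto
    then obtain m where m: "d + 1 + length W = 3 * m" by blast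
    have "f u mod 3 = (f v + d) mod 3"
      using phase_along_path[OF q(5), of 0 d] q(1-3)
      by (simp add: hd_conv_nth last_conv_nth d_def)
    then have "(f u + (1 + length W)) mod 3 = (f v + d + (1 + length W)) mod 3"
      by (metis mod_add_left_eq)
    also have "f v + d + (1 + length W) = f v + 3 * m" using m by simp
    finally show ?thesis by (simp add: add.assoc)
  qed
  \<comment> \<open>\<open>takeWhile\<close> counts the ear vertices before \<open>x\<close>, so \<open>W ! i\<close> is \<open>i + 1\<close> steps after \<open>u\<close>.\<close>
  define g where
    "g = (\<lambda>x. if x \<in> set W then f u + 1 + length (takeWhile (\<lambda>y. y \<noteq> x) W) else f x)"
  let ?R = "phase_step adj g (S \<union> set W)"
  have gS: "g x = f x" if "x \<in> S" for x using that W(4) by (auto simp: g_def)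
  have gW: "g (W ! i) = f u + 1 + i" if "i < length W" for i
  proof -
    have "takeWhile (\<lambda>y. y \<noteq> W ! i) W = take i W"
      using that W(2) by (intro takeWhile_eq_take_P_nth) (auto simp: nth_eq_iff_index_eq)
    then show ?thesis using that by (simp add: g_def)
  qed
  have old: "?R\<^sup>*\<^sup>* x y" if "x \<in> S" "y \<in> S" for x y
  proof -
    have "(phase_step adj f S)\<^sup>*\<^sup>* x y" using strong that by (simp add: phase_strong_def)
    then show ?thesis
      by (rule rtranclp_mono[THEN predicate2D, rotated]) (auto simp: phase_step_def gS)
  qed
  have "successively ?R W"
    using W(3) by (auto simp: successively_conv_nth phase_step_def gW)
  moreover have "?R u (hd W)"
    using ends W(1) gW[of 0] gS[of u] by (auto simp: phase_step_def hd_conv_nth)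
  moreover have "?R (last W) v"
    using ends W(1) gW[of "length W - 1"] gS[of v] uv
    by (cases W rule: rev_cases) (auto simp: phase_step_def)
  ultimately have chain: "successively ?R (u # W @ [v])"
    using W(1) by (auto simp: successively_Cons successively_append_iff)
  have in_out: "?R\<^sup>*\<^sup>* u x \<and> ?R\<^sup>*\<^sup>* x v" if "x \<in> S \<union> set W" for x
    using that old ends path_through_imp_rtranclp[OF chain, of x] by auto
  have "?R\<^sup>*\<^sup>* x y" if "x \<in> S \<union> set W" "y \<in> S \<union> set W" for x y
    using in_out[OF that(1)] in_out[OF that(2)] old[OF ends(2,1)] by (meson rtranclp_trans)
  then show ?thesis unfolding phase_strong_def by blast
qed

text \<open>
  Deleting \<open>w\<close> leaves \<open>u\<close> connected to some third vertex, so \<open>u\<close> has a neighbour \<open>x\<close> other than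
  \<open>w\<close>; deleting \<open>u\<close> leaves a path from \<open>w\<close> to \<open>x\<close>, which \<open>u\<close> closes to a cycle. The third
  vertex is needed: the complete graph on two vertices has no cycle.
\<close>

lemma edge_on_cycle:
  assumes sym: "\<And>x y. adj x y \<Longrightarrow> adj y x"
    and irrefl: "\<And>x. \<not> adj x x"
    and inV: "\<And>x y. adj x y \<Longrightarrow> x \<in> V"
    and conn: "\<And>x a b. x \<in> V \<Longrightarrow> a \<in> V - {x} \<Longrightarrow> b \<in> V - {x} \<Longrightarrow>
          (\<lambda>y z. y \<in> V - {x} \<and> z \<in> V - {x} \<and> adj y z)\<^sup>*\<^sup>* a b"
    and card: "3 \<le> card V"
    and uw: "adj u w"
  obtains xs where "2 \<le> length xs" "hd xs = w" "distinct xs" "u \<notin> set xs" "successively adj xs"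
    "adj (last xs) u"
proof -
  have V: "u \<in> V" "w \<in> V" "u \<noteq> w" using uw inV sym irrefl by blast+
  have "\<not> V \<subseteq> {u, w}"
  proof
    assume "V \<subseteq> {u, w}"
    then have "card V \<le> card {u, w}" by (intro card_mono) auto
    then show False using card V(3) by simp
  qed
  then obtain t where t: "t \<in> V" "t \<noteq> u" "t \<noteq> w" by blast
  have "(\<lambda>y z. y \<in> V - {w} \<and> z \<in> V - {w} \<and> adj y z)\<^sup>*\<^sup>* u t"
    using conn V t by auto
  then obtain x where x: "x \<in> V" "x \<noteq> w" "adj u x"
    using t(2) by (cases rule: converse_rtranclpE) auto
  then have "x \<noteq> u" using irrefl by blast
  then have reach: "(\<lambda>y z. y \<in> V - {u} \<and> z \<in> V - {u} \<and> adj y z)\<^sup>*\<^sup>* w x" (is "?R\<^sup>*\<^sup>* w x")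
    using conn V x by auto
  then obtain xs where xs: "xs \<noteq> []" "hd xs = w" "last xs = x" "distinct xs" "successively ?R xs"
    by (rule rtranclp_imp_path)
  have "u \<notin> set xs"
  proof
    assume "u \<in> set xs"
    then have "?R\<^sup>*\<^sup>* w u" using path_through_imp_rtranclp(1)[OF xs(5)] xs(2) by simp
    then show False using V(3) by (cases rule: rtranclp.cases) auto
  qed
  moreover have "successively adj xs" using xs(5) by (rule successively_mono) auto
  moreover have "length xs \<noteq> 1" using xs x(2) by (auto simp: length_Suc_conv)
  then have "2 \<le> length xs" using xs(1) by (cases xs) (auto simp: Suc_le_eq)
  ultimately show thesis using that xs x(3) sym by blast
qed

text \<open>
  An extremal choice replaces an ear decomposition: a phased set that is maximal under inclusion
  admits no further ear, which for these graphs means that it contains every vertex.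
\<close>

lemma phase_strong_exists:
  assumes sym: "\<And>x y. adj x y \<Longrightarrow> adj y x"
    and irrefl: "\<And>x. \<not> adj x x"
    and inV: "\<And>x y. adj x y \<Longrightarrow> x \<in> V"
    and fin: "finite V"
    and card: "3 \<le> card V"
    and conn: "\<And>a b. a \<in> V \<Longrightarrow> b \<in> V \<Longrightarrow> adj\<^sup>*\<^sup>* a b"
    and conn2: "\<And>x a b. x \<in> V \<Longrightarrow> a \<in> V - {x} \<Longrightarrow> b \<in> V - {x} \<Longrightarrow>
          (\<lambda>y z. y \<in> V - {x} \<and> z \<in> V - {x} \<and> adj y z)\<^sup>*\<^sup>* a b"
    and cyc: "\<And>xs. distinct xs \<Longrightarrow> successively adj xs \<Longrightarrow> 3 \<le> length xs \<Longrightarrow> adj (last xs) (hd xs)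
                \<Longrightarrow> 3 dvd length xs"
  shows "\<exists>f. phase_strong adj f V"
proof -
  obtain r where r: "r \<in> V" using card by fastforce
  define \<S> where "\<S> = {S. S \<subseteq> V \<and> r \<in> S \<and> (\<exists>f. phase_strong adj f S)}"
  have "finite \<S>" using fin by (auto simp: \<S>_def)
  moreover have "{r} \<in> \<S>" using r by (auto simp: \<S>_def phase_strong_def)
  ultimately obtain S where S: "S \<in> \<S>" and max: "\<And>T. T \<in> \<S> \<Longrightarrow> S \<subseteq> T \<Longrightarrow> S = T"
    using finite_has_maximal[of \<S>] by blast
  from S obtain f where f: "S \<subseteq> V" "r \<in> S" "phase_strong adj f S" by (auto simp: \<S>_def)
  have "S = V"
  proof (rule ccontr)
    assume "S \<noteq> V"
    then obtain z where z: "z \<in> V" "z \<notin> S" using f by blast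
    have "\<exists>u w. u \<in> S \<and> w \<notin> S \<and> adj u w"
    proof (rule ccontr)
      assume "\<not> ?thesis"
      then have step: "\<And>x y. x \<in> S \<Longrightarrow> adj x y \<Longrightarrow> y \<in> S" by blast
      have "adj\<^sup>*\<^sup>* r z" using conn r z by blast
      then have "z \<in> S" by (induction rule: rtranclp_induct) (use f(2) step in auto)
      then show False using z by simp
    qed
    then obtain u w where uw: "u \<in> S" "w \<notin> S" "adj u w" by blast
    obtain xs where xs: "2 \<le> length xs" "hd xs = w" "distinct xs" "u \<notin> set xs"
        "successively adj xs" "adj (last xs) u"
      by (rule edge_on_cycle[of adj V u w]) (use sym irrefl inV conn2 card uw(3) in blast)+
    \<comment> \<open>The ear is the part of the cycle before its first return to \<open>S\<close>; if there is no return
      along \<open>xs\<close>, the cycle closes at \<open>u\<close> itself and is an ear with equal ends.\<close>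
    define W where "W = takeWhile (\<lambda>x. x \<notin> S) xs"
    have xs_ne: "xs \<noteq> []" using xs(1) by auto
    have W: "W \<noteq> []" "hd W = w" "distinct W" "set W \<inter> S = {}"
      using xs xs_ne uw(2) by (cases xs; auto simp: W_def dest: set_takeWhileD)+
    have split: "xs = W @ dropWhile (\<lambda>x. x \<notin> S) xs" by (simp add: W_def)
    have sW: "successively adj W"
      using xs(5) split by (metis successively_append_iff)
    have "\<exists>v\<in>S. adj (last W) v \<and> (u \<noteq> v \<or> 2 \<le> length W)"
    proof (cases "dropWhile (\<lambda>x. x \<notin> S) xs")
      case Nil
      then have "W = xs" using split by (metis append_Nil2)
      then show ?thesis using xs uw by auto
    next
      case (Cons v ys)
      have xs_eq: "xs = W @ v # ys" using split unfolding Cons .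
      from Cons have "v \<in> S" by (simp add: dropWhile_eq_Cons_conv)
      moreover have "adj (last W) v"
        using xs(5) W(1) unfolding xs_eq by (simp add: successively_append_iff)
      moreover have "v \<in> set xs" unfolding xs_eq by simp
      ultimately show ?thesis using xs(4) by blast
    qed
    then obtain v where "v \<in> S" "adj (last W) v" "u \<noteq> v \<or> 2 \<le> length W" by blast
    then have "\<exists>g. phase_strong adj g (S \<union> set W)"
      using uw W sW f(3) by (intro extend_by_ear[of adj f S u v W] cyc) auto
    moreover have "set W \<subseteq> V"
    proof
      fix x assume "x \<in> set W"
      then have "adj\<^sup>*\<^sup>* w x" using path_through_imp_rtranclp(1)[OF sW] W(2) by simp
      then show "x \<in> V" using uw(3) by (cases rule: rtranclp.cases) (blast dest: sym inV)+
    qed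
    ultimately have "S \<union> set W \<in> \<S>" using f by (auto simp: \<S>_def)
    from max[OF this] have "set W \<subseteq> S" by blast
    then show False using W(1,4) by (cases W) auto
  qed
  then show ?thesis using f by blast
qed

section \<open>Arc walks and vertex lists\<close>

lemma (in wf_digraph) path_imp_awalk:
  assumes "successively (\<lambda>x y. x \<rightarrow>\<^bsub>G\<^esub> y) (u # xs)" "u \<in> verts G"
  obtains p where "awalk u p (last (u # xs))" "awalk_verts u p = u # xs"
proof -
  from assms have "\<exists>p. awalk u p (last (u # xs)) \<and> awalk_verts u p = u # xs"
  proof (induction xs arbitrary: u)
    case Nil
    then show ?case by (intro exI[of _ "[]"]) (simp add: awalk_Nil_iff)
  next
    case (Cons x xs)
    then obtain e where e: "e \<in> arcs G" "tail G e = u" "head G e = x" by auto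
    then have "x \<in> verts G" by auto
    with Cons obtain p where "awalk x p (last (x # xs))" "awalk_verts x p = x # xs" by auto
    then show ?case using e by (intro exI[of _ "e # p"]) (auto simp: awalk_Cons_iff)
  qed
  then show thesis using that by blast
qed

lemma (in wf_digraph) arc_edge_nth:
  assumes "awalk u p v" "i < length p"
  shows "arc_edge G (p ! i) = {awalk_verts u p ! i, awalk_verts u p ! Suc i}"
  using assms
proof (induction p arbitrary: u i)
  case (Cons e p)
  then show ?case
    by (cases i; cases p) (auto simp: awalk_Cons_iff arc_edge_def)
qed simp

lemma connected_induce_imp_rtranclp:
  assumes "Digraph_Component.connected (G \<restriction> W)" "symmetric G" "a \<in> W" "b \<in> W"
  shows "(\<lambda>x y. x \<in> W \<and> y \<in> W \<and> (x, y) \<in> arcs_ends G)\<^sup>*\<^sup>* a b"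
proof -
  let ?H = "with_proj (mk_symmetric (G \<restriction> W))"
  have "a \<rightarrow>\<^sup>*\<^bsub>?H\<^esub> b"
    using assms by (auto simp: connected_def strongly_connected_def mk_symmetric_def)
  then have "(a, b) \<in> (arcs_ends ?H)\<^sup>*" by (rule reachable_rtranclI)
  moreover have "arcs_ends ?H \<subseteq> {(x, y). x \<in> W \<and> y \<in> W \<and> (x, y) \<in> arcs_ends G}"
    using arcs_ends_symmetric[OF assms(2)]
    by (auto simp: mk_symmetric_def arcs_ends_conv)
  ultimately have "(a, b) \<in> {(x, y). x \<in> W \<and> y \<in> W \<and> (x, y) \<in> arcs_ends G}\<^sup>*"
    using rtrancl_mono by blast
  then show ?thesis by (simp add: rtranclp_rtrancl_eq)
qed

text \<open>
  The sum of the phases does not depend on the direction in which the edge is traversed.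
\<close>

definition phase_colouring :: "('a \<Rightarrow> nat) \<Rightarrow> 'a set \<Rightarrow> nat" where
  "phase_colouring f e = sum f e mod 3"

text \<open>
  Edges at distance one or two on a rising path start at phases \<open>a\<close> and \<open>b\<close> that differ by one or
  two. As 2 is invertible modulo 3, their colours differ too.
\<close>

lemma twice_shift_mod_3:
  fixes a b k :: nat
  assumes "b mod 3 = (a + k) mod 3" "k = 1 \<or> k = 2"
  shows "(2 * a + 1) mod 3 \<noteq> (2 * b + 1) mod 3"
proof -
  have "(2 * b + 1) mod 3 = (2 * (a + k) + 1) mod 3"
    by (metis assms(1) mod_add_left_eq mod_mult_right_eq)
  moreover have "(2 * (a + k) + 1) mod 3 = (2 * a + 1) mod 3 \<longleftrightarrow> 3 dvd (2 * k)"
    by (subst mod_eq_dvd_iff_nat) auto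
  moreover have "\<not> 3 dvd (2 * k)" using assms(2) by auto
  ultimately show ?thesis by metis
qed

lemma (in graph) phase_path_strongly_proper:
  assumes steps: "successively (phase_step (\<lambda>x y. x \<rightarrow>\<^bsub>G\<^esub> y) f S) (awalk_verts u p)"
    and p: "apath u p v"
  shows "strongly_proper G (phase_colouring f) p"
  unfolding strongly_proper_def
proof (intro allI impI)
  fix i j assume ij: "i < j \<and> j \<le> i + 2 \<and> j < length p"
  let ?zs = "awalk_verts u p"
  have walk: "awalk u p v" and dist: "distinct ?zs" using p by (auto simp: apath_def)
  have len: "length ?zs = Suc (length p)" by (simp add: length_awalk_verts)
  have colour: "phase_colouring f (arc_edge G (p ! k)) = (2 * f (?zs ! k) + 1) mod 3"
    if "k < length p" for k
  proof -
    have "?zs ! k \<noteq> ?zs ! Suc k" using dist len that by (simp add: nth_eq_iff_index_eq)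
    then have "phase_colouring f (arc_edge G (p ! k)) = (f (?zs ! k) + f (?zs ! Suc k)) mod 3"
      using that by (simp add: phase_colouring_def arc_edge_nth[OF walk])
    moreover have "f (?zs ! Suc k) mod 3 = (f (?zs ! k) + 1) mod 3"
      using phase_along_path[OF steps, of k 1] len that by simp
    ultimately have "phase_colouring f (arc_edge G (p ! k)) = (f (?zs ! k) + (f (?zs ! k) + 1)) mod 3"
      by (metis mod_add_right_eq)
    then show ?thesis by (simp add: mult_2)
  qed
  have "f (?zs ! j) mod 3 = (f (?zs ! i) + (j - i)) mod 3"
    using phase_along_path[OF steps, of i "j - i"] ij len by simp
  moreover from ij have "j - i = 1 \<or> j - i = 2" by auto
  ultimately have "(2 * f (?zs ! i) + 1) mod 3 \<noteq> (2 * f (?zs ! j) + 1) mod 3"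
    using twice_shift_mod_3 by blast
  then show "phase_colouring f (arc_edge G (p ! i)) \<noteq> phase_colouring f (arc_edge G (p ! j))"
    using ij by (simp add: colour)
qed

section \<open>Three colours suffice\<close>

lemma spc_le:
  assumes "strongly_proper_connected G c" "c ` edges G \<subseteq> {..<k}"
  shows "spc G \<le> k"
proof -
  have "spc G \<le> card (c ` edges G)"
    unfolding spc_def using assms(1) by (intro Least_le) blast
  also have "\<dots> \<le> k" using card_mono[OF _ assms(2)] by simp
  finally show ?thesis .
qed

theorem theorem3:
  fixes G :: "('a,'b) pre_digraph"
  assumes "graph G"
    and "Digraph_Component.connected G"
    and "k_connected 2 G"
    and "\<And>p. graph_cycle G p \<Longrightarrow> 3 dvd length p"
  shows "spc G \<le> 3"
proof -
  interpret graph G by fact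
  let ?adj = "\<lambda>x y. x \<rightarrow>\<^bsub>G\<^esub> y"
  have sym: "?adj x y \<Longrightarrow> ?adj y x" for x y using arcs_ends_symmetric[OF sym_arcs] by blast
  have conn: "?adj\<^sup>*\<^sup>* a b" if "a \<in> verts G" "b \<in> verts G" for a b
  proof -
    have "Digraph_Component.connected (G \<restriction> (verts G - {}))"
      using assms(3)[unfolded k_connected_def, rule_format, of "{}"] that by auto
    then have "(\<lambda>x y. x \<in> verts G - {} \<and> y \<in> verts G - {} \<and> ?adj x y)\<^sup>*\<^sup>* a b"
      by (rule connected_induce_imp_rtranclp[OF _ sym_arcs]) (use that in auto)
    then show ?thesis by (rule rtranclp_mono[THEN predicate2D, rotated]) auto
  qed
  show ?thesis
  proof (cases "3 \<le> card (verts G)")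
    \<comment> \<open>With at most two vertices there need not be any cycle, but paths have at most one edge.\<close>
    case False
    have "strongly_proper_connected G (\<lambda>_. 0)"
      unfolding strongly_proper_connected_def
    proof (intro ballI impI)
      fix u v assume "u \<in> verts G" "v \<in> verts G" "u \<noteq> v"
      then have "u \<rightarrow>\<^sup>*\<^bsub>G\<^esub> v" using conn by (simp add: reachable_conv rtranclp_rtrancl_eq)
      then obtain p where p: "apath u p v" using reachable_apath by blast
      then have "length p < 2" using False length_apath_less[OF p] by simp
      then show "\<exists>p. apath u p v \<and> strongly_proper G (\<lambda>_. 0) p"
        using p by (intro exI[of _ p]) (auto simp: strongly_proper_def)
    qed
    then show ?thesis by (rule spc_le) auto
  next
    case True
    have conn2: "(\<lambda>y z. y \<in> verts G - {x} \<and> z \<in> verts G - {x} \<and> ?adj y z)\<^sup>*\<^sup>* a b"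
      if "x \<in> verts G" "a \<in> verts G - {x}" "b \<in> verts G - {x}" for x a b
    proof -
      have "Digraph_Component.connected (G \<restriction> (verts G - {x}))"
        using assms(3)[unfolded k_connected_def, rule_format, of "{x}"] that by auto
      from connected_induce_imp_rtranclp[OF this sym_arcs that(2,3)] show ?thesis .
    qed
    have cyc: "3 dvd length xs"
      if xs: "distinct xs" "successively ?adj xs" "3 \<le> length xs" "?adj (last xs) (hd xs)" for xs
    proof -
      have "xs \<noteq> []" using xs(3) by auto
      then have "successively ?adj (last xs # xs)" using xs by (simp add: successively_Cons)
      then obtain p where p: "awalk (last xs) p (last xs)" "awalk_verts (last xs) p = last xs # xs"
        using path_imp_awalk[of "last xs" xs] xs(4) adj_in_verts \<open>xs \<noteq> []\<close> by auto
      then have len: "length p = length xs"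
        using length_awalk_verts[of "last xs" p] by simp
      then have "graph_cycle G p"
        using p xs by (auto simp: graph_cycle_def cycle_def)
      then show ?thesis using assms(4)[of p] len by simp
    qed
    have "\<exists>f. phase_strong ?adj f (verts G)"
    proof (rule phase_strong_exists)
      show "finite (verts G)" by simp
      show "3 \<le> card (verts G)" by (fact True)
      show "?adj y x" if "?adj x y" for x y using that by (rule sym)
      show "\<not> ?adj x x" for x using adj_not_same by blast
      show "x \<in> verts G" if "?adj x y" for x y using that by (rule adj_in_verts)
      show "?adj\<^sup>*\<^sup>* a b" if "a \<in> verts G" "b \<in> verts G" for a b
        using that by (rule conn)
      show "(\<lambda>y z. y \<in> verts G - {x} \<and> z \<in> verts G - {x} \<and> ?adj y z)\<^sup>*\<^sup>* a b"
        if "x \<in> verts G" "a \<in> verts G - {x}" "b \<in> verts G - {x}" for x a b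
        using that by (rule conn2)
      show "3 dvd length xs" if "distinct xs" "successively ?adj xs" "3 \<le> length xs"
        "?adj (last xs) (hd xs)" for xs
        using that by (rule cyc)
    qed
    then obtain f where f: "phase_strong ?adj f (verts G)" ..
    have "strongly_proper_connected G (phase_colouring f)"
      unfolding strongly_proper_connected_def
    proof (intro ballI impI)
      fix u v assume uv: "u \<in> verts G" "v \<in> verts G" "u \<noteq> v"
      let ?R = "phase_step ?adj f (verts G)"
      have "?R\<^sup>*\<^sup>* u v" using f uv by (simp add: phase_strong_def)
      then obtain xs where xs: "xs \<noteq> []" "hd xs = u" "last xs = v" "distinct xs" "successively ?R xs"
        by (rule rtranclp_imp_path)
      then obtain ys where ys: "xs = u # ys" by (cases xs) auto
      have "successively ?adj xs"
        using xs(5) by (rule successively_mono) (auto simp: phase_step_def)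
      then obtain p where p: "awalk u p v" "awalk_verts u p = xs"
        using path_imp_awalk[of u ys] uv(1) xs(3) ys by auto
      then have "apath u p v" using xs(4) by (simp add: apath_def)
      then show "\<exists>p. apath u p v \<and> strongly_proper G (phase_colouring f) p"
        using phase_path_strongly_proper[of f "verts G" u p v] p xs(5) by auto
    qed
    then show ?thesis by (rule spc_le) (auto simp: phase_colouring_def)
  qed
qed

end
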